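(* For positive integers $\ell$ and $d$, define $h_\ell(d)$ by $$h_\ell(d)-1:=\max\{|E(G)| : G \text{ a graph with } \Delta(G)\le d \text{ and } \operatorname{diam} L(G)\le \ell\}.$$ Then for every fixed integer $\ell\ge 2$, $$\liminf_{d\to\infty}\frac{h_\ell(d)}{d^\ell}\ge 1.$$
   Context: Graphs are finite, simple and undirected. $E(G)$ is the edge set of $G$ and $\Delta(G)$ its maximum degree. $L(G)$ is the line graph of $G$: its vertices are the edges of $G$, and two distinct edges of $G$ are adjacent in $L(G)$ if they share an endpoint. The diameter of a graph is the maximum graph distance between two of its vertices (infinite if the graph is disconnected, and $0$ for the graph with no vertices). The liminf is over all positive integers $d\to\infty$. *)

theory Defs
  imports "HOL-Library.Extended_Nat" "HOL-Library.Extended_Real" "HOL-Library.Liminf_Limsup"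
begin

definition simple_graph :: "'a set \<Rightarrow> 'a set set \<Rightarrow> bool" where
  "simple_graph V E \<longleftrightarrow> finite V \<and> (\<forall>e\<in>E. e \<subseteq> V \<and> card e = 2)"

definition degree :: "'a set set \<Rightarrow> 'a \<Rightarrow> nat" where
  "degree E v = card {e \<in> E. v \<in> e}"

text \<open>The inserted 0 only matters for the graph with no vertices.\<close>

definition max_degree :: "'a set \<Rightarrow> 'a set set \<Rightarrow> nat" where
  "max_degree V E = Max (insert 0 (degree E ` V))"

definition walk :: "'a set \<Rightarrow> 'a set set \<Rightarrow> 'a list \<Rightarrow> bool" where
  "walk V E xs \<longleftrightarrow> xs \<noteq> [] \<and> set xs \<subseteq> V \<and> successively (\<lambda>u v. {u, v} \<in> E) xs"

text \<open>In \<^typ>\<open>enat\<close> the infimum of the empty set is \<open>\<infinity>\<close> and its supremum is 0. So vertices in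
  different components are at distance \<open>\<infinity>\<close>, a disconnected graph has diameter \<open>\<infinity>\<close>, and the graph
  with no vertices has diameter 0.\<close>

definition graph_dist :: "'a set \<Rightarrow> 'a set set \<Rightarrow> 'a \<Rightarrow> 'a \<Rightarrow> enat" where
  "graph_dist V E u v = (INF xs\<in>{xs. walk V E xs \<and> hd xs = u \<and> last xs = v}. enat (length xs - 1))"

definition diam :: "'a set \<Rightarrow> 'a set set \<Rightarrow> enat" where
  "diam V E = (SUP u\<in>V. SUP v\<in>V. graph_dist V E u v)"

text \<open>The line graph of a graph with edge set \<open>E\<close> has vertex set \<open>E\<close> and the following edges.\<close>

definition line_graph_edges :: "'a set set \<Rightarrow> 'a set set set" where
  "line_graph_edges E = {{e, f} | e f. e \<in> E \<and> f \<in> E \<and> e \<noteq> f \<and> e \<inter> f \<noteq> {}}"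

text \<open>Every finite graph is isomorphic to one whose vertices are natural numbers, so graphs on finite
  sets of naturals suffice. The set below contains 0 (the empty graph), and for fixed \<open>l\<close> and \<open>d\<close> it
  is bounded, since line graphs of such graphs have maximum degree at most \<open>2 * d\<close> and diameter at
  most \<open>l\<close>; hence \<^const>\<open>Max\<close> is a genuine maximum.\<close>

definition h :: "nat \<Rightarrow> nat \<Rightarrow> nat" where
  "h l d = Max {card E | (V :: nat set) E.
     simple_graph V E \<and> max_degree V E \<le> d \<and> diam E (line_graph_edges E) \<le> enat l} + 1"

end

theory Submission
  imports Defs "HOL-Library.FuncSet" "HOL-Library.Z2" "HOL-Algebra.Algebraic_Closure_Type"
    "HOL-Analysis.Kronecker_Approximation_Theorem" "HOL-Real_Asymp.Real_Asymp"
begin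

text \<open>
  The edges of the graph are the complete flags of an \<open>l\<close>-dimensional vector space over a field with
  \<open>q\<close> elements; its vertices are the families of the even-indexed and of the odd-indexed subspaces of
  such flags. Each subspace of a flag can be replaced in at most \<open>q + 1\<close> ways, so a family with \<open>m\<close>
  subspaces missing has degree at most \<open>(q + 1)^m\<close>, while there are at least \<open>q^(l(l-1)/2)\<close> flags. Any
  flag is turned into any other in \<open>l\<close> rounds which alternately replace the odd-indexed and the
  even-indexed subspaces: this is odd-even transposition sort, applied to the relative position of
  the two flags. So the line graph has diameter at most \<open>l\<close>.

  The construction is compatible with products. The product with the mirror image makes both sides
  have degree at most \<open>(q + 1)^(l-1)\<close>, with \<open>q^(l(l-1))\<close> edges. The product over \<open>q = 2^a\<close> and
  \<open>q = 3^b\<close> reaches, up to a factor close to 1, every degree \<open>d\<close>, because the numbers \<open>2^a 3^b\<close> with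
  large \<open>a\<close> and \<open>b\<close> are multiplicatively dense; this replaces an appeal to the distribution of primes.
\<close>

section \<open>Graphs from chamber systems\<close>

lemma finite_edges: "simple_graph V E \<Longrightarrow> finite E"
  unfolding simple_graph_def by (rule finite_subset[of _ "Pow V"]) auto

lemma card_incident_edges_le:
  assumes "simple_graph V E" "max_degree V E \<le> d" "v \<in> V"
  shows "card {e \<in> E. v \<in> e} \<le> d"
proof -
  have "Defs.degree E v \<le> max_degree V E"
    unfolding max_degree_def using assms by (intro Max_ge) (auto simp: simple_graph_def)
  then show ?thesis using assms unfolding Defs.degree_def by simp
qed

lemma card_meeting_edges_le:
  assumes G: "simple_graph V E" "max_degree V E \<le> d" and e: "e \<in> E"
  shows "card {f \<in> E. f \<inter> e \<noteq> {}} \<le> 2 * d"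
proof -
  have fin: "finite E" using finite_edges[OF G(1)] .
  have ce: "card e = 2" "e \<subseteq> V" using G e by (auto simp: simple_graph_def)
  have "{f \<in> E. f \<inter> e \<noteq> {}} \<subseteq> (\<Union>v\<in>e. {f \<in> E. v \<in> f})" by auto
  then have "card {f \<in> E. f \<inter> e \<noteq> {}} \<le> card (\<Union>v\<in>e. {f \<in> E. v \<in> f})"
    using fin ce by (intro card_mono) (auto intro!: finite_UN_I simp: card_ge_0_finite)
  also have "\<dots> \<le> (\<Sum>v\<in>e. card {f \<in> E. v \<in> f})"
    by (rule card_UN_le) (use ce in \<open>simp add: card_ge_0_finite\<close>)
  also have "\<dots> \<le> (\<Sum>v\<in>e. d)"
    using card_incident_edges_le[OF G] ce by (intro sum_mono) auto
  also have "\<dots> = 2 * d" using ce by simp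
  finally show ?thesis .
qed

text \<open>A finite infimum in \<open>enat\<close> belongs to a nonempty set and is attained
  there.\<close>

lemma graph_dist_le_obtain_walk:
  assumes "graph_dist V E u v \<le> enat l"
  obtains xs where "walk V E xs" "hd xs = u" "last xs = v" "length xs \<le> Suc l"
proof -
  let ?S = "{xs. walk V E xs \<and> hd xs = u \<and> last xs = v}"
  let ?I = "(\<lambda>xs. enat (length xs - 1)) ` ?S"
  have "?I \<noteq> {}"
  proof
    assume "?I = {}"
    then have "graph_dist V E u v = \<infinity>" unfolding graph_dist_def by (simp add: Inf_enat_def)
    then show False using assms by simp
  qed
  then have "Inf ?I \<in> ?I" unfolding Inf_enat_def using LeastI_ex[of "\<lambda>x. x \<in> ?I"] by auto
  then obtain xs where "xs \<in> ?S" "graph_dist V E u v = enat (length xs - 1)"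
    unfolding graph_dist_def by auto
  then show thesis using assms that by fastforce
qed

text \<open>A ball in the line graph grows by a factor of at most \<open>2 * d\<close> per unit of
  radius, because an edge meets at most \<open>2 * d\<close> edges, itself included. The ball of
  radius \<open>l\<close> contains every edge.\<close>

lemma card_edges_le:
  assumes G: "simple_graph V E" "max_degree V E \<le> d" "diam E (line_graph_edges E) \<le> enat l"
  shows "card E \<le> (2 * d) ^ l"
proof (cases "E = {}")
  case False
  then obtain e where e: "e \<in> E" by auto
  have fin: "finite E" using finite_edges[OF G(1)] .
  \<comment> \<open>\<open>B k\<close> plays the role of the ball of radius \<open>k\<close> around
    \<open>e\<close>; as every edge meets itself, these sets increase with \<open>k\<close>.\<close>
  define N where "N e = {f \<in> E. f \<inter> e \<noteq> {}}" for e
  define B where "B = rec_nat {e} (\<lambda>_ S. \<Union> (N ` S))"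
  have B0: "B 0 = {e}" and BS: "B (Suc k) = \<Union> (N ` B k)" for k
    by (simp_all add: B_def)
  have BE: "B k \<subseteq> E" for k by (induction k) (auto simp: B0 BS e N_def)
  have self: "f \<in> N f" if "f \<in> E" for f
    using that G(1) by (auto simp: N_def simple_graph_def)
  have mono1: "B k \<subseteq> B (Suc k)" for k using BE self by (fastforce simp: BS)
  have mono: "B k \<subseteq> B m" if "k \<le> m" for k m using mono1 that by (rule lift_Suc_mono_le[of B])
  have cB: "card (B k) \<le> (2 * d) ^ k" for k
  proof (induction k)
    case (Suc k)
    have "card (B (Suc k)) \<le> (\<Sum>f\<in>B k. card (N f))"
      unfolding BS by (rule card_UN_le) (use BE fin finite_subset in blast)
    also have "\<dots> \<le> (\<Sum>f\<in>B k. 2 * d)"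
      using card_meeting_edges_le[OF G(1,2)] BE by (intro sum_mono) (auto simp: N_def)
    also have "\<dots> \<le> (2 * d) ^ Suc k" using Suc by simp
    finally show ?case .
  qed (simp add: B0)
  have walk_B: "last xs \<in> B (length xs - 1)"
    if "walk E (line_graph_edges E) xs" "hd xs = e" for xs
    using that
  proof (induction xs rule: rev_induct)
    case (snoc f xs)
    show ?case
    proof (cases "xs = []")
      case True then show ?thesis using snoc B0 by simp
    next
      case False
      then have "last xs \<in> B (length xs - 1)"
        using snoc by (auto simp: walk_def successively_append_iff)
      moreover have "{last xs, f} \<in> line_graph_edges E"
        using snoc False by (auto simp: walk_def successively_append_iff)
      then have "f \<in> N (last xs)" by (auto simp: line_graph_edges_def N_def doubleton_eq_iff)
      moreover have "length xs = Suc (length xs - 1)" using False by (cases xs) auto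
      ultimately show ?thesis using BS[of "length xs - 1"] by auto
    qed
  qed (simp add: walk_def)
  have "E \<subseteq> B l"
  proof
    fix f assume f: "f \<in> E"
    have "graph_dist E (line_graph_edges E) e f \<le> diam E (line_graph_edges E)"
      unfolding diam_def using e f by (intro SUP_upper2[OF e] SUP_upper) auto
    then have "graph_dist E (line_graph_edges E) e f \<le> enat l" using G(3) by simp
    then obtain xs where xs: "walk E (line_graph_edges E) xs" "hd xs = e" "last xs = f"
      "length xs \<le> Suc l" by (rule graph_dist_le_obtain_walk)
    have "length xs - 1 \<le> l" using xs(4) by simp
    then show "f \<in> B l" using walk_B[OF xs(1,2)] mono[of "length xs - 1" l] xs(3) by blast
  qed
  then have "card E \<le> card (B l)" using BE fin by (intro card_mono) (auto intro: finite_subset)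
  with cB show ?thesis using order_trans by blast
qed simp

text \<open>Boundedness of the edge counts makes \<open>Max\<close> a true upper bound; strictness
  is the \<open>+ 1\<close> in \<open>h\<close>.\<close>

lemma card_edges_less_h:
  fixes V :: "nat set"
  assumes "simple_graph V E" "max_degree V E \<le> d" "diam E (line_graph_edges E) \<le> enat l"
  shows "card E < h l d"
proof -
  let ?S = "{card E | (V :: nat set) E.
     simple_graph V E \<and> max_degree V E \<le> d \<and> diam E (line_graph_edges E) \<le> enat l}"
  have "?S \<subseteq> {..(2 * d) ^ l}" using card_edges_le by blast
  then have "finite ?S" by (rule finite_subset) simp
  then have "card E \<le> Max ?S" using assms by (intro Max_ge) blast+
  then show ?thesis by (simp add: h_def)
qed

section \<open>Chamber systems, their products and their graphs\<close>

text \<open>A chain of edges may stall, but equal edges are not adjacent in the line graph.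
  Contracting the stalls gives a walk that is no longer than the chain.\<close>

lemma walk_remdups_adj:
  assumes "xs \<noteq> []" "set xs \<subseteq> E" "successively (\<lambda>e f. e \<inter> f \<noteq> {}) xs"
  shows "walk E (line_graph_edges E) (remdups_adj xs)"
  using assms
proof (induction xs rule: remdups_adj.induct)
  case (3 x y xs)
  show ?case
  proof (cases "x = y")
    case False
    then have "{x, y} \<in> line_graph_edges E" using 3(3,4,5) by (auto simp: line_graph_edges_def)
    moreover have "walk E (line_graph_edges E) (remdups_adj (y # xs))"
      using 3 False by auto
    ultimately show ?thesis using False 3(4) by (auto simp: walk_def successively_Cons)
  qed (use 3 in auto)
qed (auto simp: walk_def)

text \<open>A chamber system below is the edge set of a bipartite graph: an element \<open>x\<close> of \<open>C\<close> is an edge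
  whose two endpoints are \<open>f x\<close> and \<open>g x\<close>.\<close>

definition alternating_chain ::
    "'a set \<Rightarrow> ('a \<Rightarrow> 'b) \<Rightarrow> ('a \<Rightarrow> 'c) \<Rightarrow> nat \<Rightarrow> 'a \<Rightarrow> 'a \<Rightarrow> bool" where
  "alternating_chain C f g l x y \<longleftrightarrow> (\<exists>c. c 0 = x \<and> c l = y \<and> (\<forall>t\<le>l. c t \<in> C) \<and>
     (\<forall>t<l. if even t then f (c t) = f (c (Suc t)) else g (c t) = g (c (Suc t))))"

text \<open>Injectivity makes distinct elements distinct edges. Chains are required with either side
  kept first, so that \<open>f\<close> and \<open>g\<close> can be exchanged.\<close>

definition chamber_system ::
    "nat \<Rightarrow> 'a set \<Rightarrow> ('a \<Rightarrow> 'b) \<Rightarrow> ('a \<Rightarrow> 'c) \<Rightarrow> nat \<Rightarrow> nat \<Rightarrow> bool" where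
  "chamber_system l C f g a b \<longleftrightarrow> finite C \<and> inj_on (\<lambda>x. (f x, g x)) C \<and>
     (\<forall>x\<in>C. card {y \<in> C. f y = f x} \<le> a) \<and> (\<forall>x\<in>C. card {y \<in> C. g y = g x} \<le> b) \<and>
     (\<forall>x\<in>C. \<forall>y\<in>C. alternating_chain C f g l x y \<and> alternating_chain C g f l x y)"

lemma chamber_system_swap: "chamber_system l C f g a b \<Longrightarrow> chamber_system l C g f b a"
  by (auto simp: chamber_system_def inj_on_def)

text \<open>Chains have exactly \<open>l\<close> rounds and keep the same side in the same round, so
  two of them run in parallel.\<close>

lemma alternating_chain_prod:
  assumes "alternating_chain C f g l x y" "alternating_chain C' f' g' l x' y'"
  shows "alternating_chain (C \<times> C') (map_prod f f') (map_prod g g') l (x, x') (y, y')"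
proof -
  obtain c where c: "c 0 = x" "c l = y" "\<forall>t\<le>l. c t \<in> C"
    "\<forall>t<l. if even t then f (c t) = f (c (Suc t)) else g (c t) = g (c (Suc t))"
    using assms(1) by (auto simp: alternating_chain_def)
  obtain c' where c': "c' 0 = x'" "c' l = y'" "\<forall>t\<le>l. c' t \<in> C'"
    "\<forall>t<l. if even t then f' (c' t) = f' (c' (Suc t)) else g' (c' t) = g' (c' (Suc t))"
    using assms(2) by (auto simp: alternating_chain_def)
  show ?thesis unfolding alternating_chain_def
    by (rule exI[of _ "\<lambda>t. (c t, c' t)"]) (use c c' in auto)
qed

lemma chamber_system_prod:
  assumes "chamber_system l C f g a b" "chamber_system l C' f' g' a' b'"
  shows "chamber_system l (C \<times> C') (map_prod f f') (map_prod g g') (a * a') (b * b')"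
proof -
  have fib: "card {y \<in> C \<times> C'. map_prod u u' y = map_prod u u' x} \<le> m * m'"
    if "\<forall>x\<in>C. card {y \<in> C. u y = u x} \<le> m" "\<forall>x\<in>C'. card {y \<in> C'. u' y = u' x} \<le> m'" "x \<in> C \<times> C'"
    for u :: "'a \<Rightarrow> 'z" and u' :: "'d \<Rightarrow> 'w" and m m' x
  proof -
    have "{y \<in> C \<times> C'. map_prod u u' y = map_prod u u' x} =
        {y \<in> C. u y = u (fst x)} \<times> {y \<in> C'. u' y = u' (snd x)}"
      by (cases x) auto
    then show ?thesis using that by (auto simp: card_cartesian_product intro!: mult_mono)
  qed
  show ?thesis
    using assms fib[of f a f' a'] fib[of g b g' b']
    unfolding chamber_system_def by (auto simp: inj_on_def intro!: alternating_chain_prod)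
qed

text \<open>The tags \<open>Inl\<close> and \<open>Inr\<close> keep the two sides apart, so there
  are no loops, and \<open>\<phi>\<close> encodes the vertices as naturals as \<open>h\<close>
  demands. Fibres of \<open>f\<close> and \<open>g\<close> bound the degrees; successive members of
  a chain share the vertex that is kept.\<close>

lemma chamber_system_less_h:
  assumes C: "chamber_system l C f g a b" and "a \<le> d" "b \<le> d"
  shows "card C < h l d"
proof -
  have fin: "finite C" using C by (simp add: chamber_system_def)
  define A where "A = Inl ` f ` C \<union> Inr ` g ` C"
  have "finite A" using fin by (simp add: A_def)
  then obtain \<phi> :: "_ \<Rightarrow> nat" where \<phi>: "inj_on \<phi> A"
    using finite_imp_inj_to_nat_seg by metis
  have Inl: "Inl (f x) \<in> A" and Inr: "Inr (g x) \<in> A" if "x \<in> C" for x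
    using that by (auto simp: A_def)
  define \<epsilon> where "\<epsilon> x = {\<phi> (Inl (f x)), \<phi> (Inr (g x))}" for x
  have neq: "\<phi> (Inl (f x)) \<noteq> \<phi> (Inr (g y))" if "x \<in> C" "y \<in> C" for x y
    using inj_onD[OF \<phi>, OF _ Inl Inr] that by blast
  have eqf: "\<phi> (Inl (f x)) = \<phi> (Inl (f y)) \<longleftrightarrow> f x = f y"
    and eqg: "\<phi> (Inr (g x)) = \<phi> (Inr (g y)) \<longleftrightarrow> g x = g y" if "x \<in> C" "y \<in> C" for x y
    using inj_on_eq_iff[OF \<phi> Inl Inl] inj_on_eq_iff[OF \<phi> Inr Inr] that by auto
  have inj: "inj_on \<epsilon> C"
  proof (rule inj_onI)
    fix x y assume "x \<in> C" "y \<in> C" "\<epsilon> x = \<epsilon> y"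
    then have "f x = f y" "g x = g y"
      using neq eqf eqg by (auto simp: \<epsilon>_def doubleton_eq_iff)
    then show "x = y" using C \<open>x \<in> C\<close> \<open>y \<in> C\<close> by (auto simp: chamber_system_def inj_on_def)
  qed
  define V where "V = \<phi> ` A"
  define E where "E = \<epsilon> ` C"
  have simple: "simple_graph V E"
    unfolding simple_graph_def
    using \<open>finite A\<close> neq Inl Inr by (auto simp: V_def E_def \<epsilon>_def)
  have deg: "Defs.degree E v \<le> d" if v: "v \<in> V" for v
  proof -
    obtain x where x: "x \<in> C" "v = \<phi> (Inl (f x)) \<or> v = \<phi> (Inr (g x))"
      using v unfolding V_def A_def by blast
    from x(2) show ?thesis
    proof
      assume v: "v = \<phi> (Inl (f x))"
      have "{e \<in> E. v \<in> e} \<subseteq> \<epsilon> ` {y \<in> C. f y = f x}"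
        using neq eqf x(1) by (auto simp: E_def \<epsilon>_def v)
      then have "Defs.degree E v \<le> card {y \<in> C. f y = f x}"
        unfolding Defs.degree_def using fin by (intro surj_card_le) auto
      also have "\<dots> \<le> a" using C x(1) by (auto simp: chamber_system_def)
      finally show ?thesis using assms by simp
    next
      assume v: "v = \<phi> (Inr (g x))"
      have "v \<noteq> \<phi> (Inl (f y))" if "y \<in> C" for y
        using neq[OF that x(1)] v by simp
      then have "{e \<in> E. v \<in> e} \<subseteq> \<epsilon> ` {y \<in> C. g y = g x}"
        using eqg x(1) by (auto simp: E_def \<epsilon>_def v)
      then have "Defs.degree E v \<le> card {y \<in> C. g y = g x}"
        unfolding Defs.degree_def using fin by (intro surj_card_le) auto
      also have "\<dots> \<le> b" using C x(1) by (auto simp: chamber_system_def)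
      finally show ?thesis using assms by simp
    qed
  qed
  have "max_degree V E \<le> d"
    unfolding max_degree_def using \<open>finite A\<close> deg by (subst Max_le_iff) (auto simp: V_def)
  moreover have "diam E (line_graph_edges E) \<le> enat l"
    unfolding diam_def
  proof (intro SUP_least)
    fix e e' assume "e \<in> E" "e' \<in> E"
    then obtain x y where xy: "x \<in> C" "y \<in> C" "e = \<epsilon> x" "e' = \<epsilon> y" by (auto simp: E_def)
    then have "alternating_chain C f g l x y" using C by (simp add: chamber_system_def)
    then obtain c where c: "c 0 = x" "c l = y" "\<And>t. t \<le> l \<Longrightarrow> c t \<in> C"
      "\<And>t. t < l \<Longrightarrow> if even t then f (c t) = f (c (Suc t)) else g (c t) = g (c (Suc t))"
      unfolding alternating_chain_def by blast
    define xs where "xs = map (\<lambda>t. \<epsilon> (c t)) [0..<Suc l]"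
    have xs: "xs \<noteq> []" "hd xs = e" "last xs = e'" "length xs = Suc l"
      using c xy by (auto simp: xs_def hd_map last_map simp del: upt_Suc)
    have "set xs \<subseteq> E" using c(3) by (auto simp: xs_def E_def)
    moreover have "successively (\<lambda>e f. e \<inter> f \<noteq> {}) xs"
      unfolding successively_conv_nth
    proof (intro allI impI)
      fix t assume t: "Suc t < length xs"
      then have "\<epsilon> (c t) \<inter> \<epsilon> (c (Suc t)) \<noteq> {}"
        using c(4)[of t] xs(4) by (auto simp: \<epsilon>_def split: if_splits)
      then show "xs ! t \<inter> xs ! Suc t \<noteq> {}"
        using t xs(4) by (simp add: xs_def nth_append del: upt_Suc)
    qed
    ultimately have "walk E (line_graph_edges E) (remdups_adj xs)"
      using walk_remdups_adj xs(1) by blast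
    then have "graph_dist E (line_graph_edges E) e e' \<le> enat (length (remdups_adj xs) - 1)"
      unfolding graph_dist_def using xs by (intro INF_lower) auto
    also have "\<dots> \<le> enat l" using remdups_adj_length[of xs] xs(4) by simp
    finally show "graph_dist E (line_graph_edges E) e e' \<le> enat l" .
  qed
  ultimately have "card E < h l d" using card_edges_less_h[OF simple] by blast
  moreover have "card E = card C" unfolding E_def using inj by (rule card_image)
  ultimately show ?thesis by simp
qed

section \<open>Flags\<close>

text \<open>Vectors are elements of the ambient field, which is a vector space over its subfield \<open>K\<close>.\<close>

locale finite_space =
  fixes K V :: "'f :: field set" and n :: nat
  assumes finite_V: "finite V" and finite_K: "finite K"
    and K_closed: "0 \<in> K" "1 \<in> K" "\<And>a b. a \<in> K \<Longrightarrow> b \<in> K \<Longrightarrow> a + b \<in> K"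
      "\<And>a b. a \<in> K \<Longrightarrow> b \<in> K \<Longrightarrow> a * b \<in> K" "\<And>a. a \<in> K \<Longrightarrow> - a \<in> K" "\<And>a. a \<in> K \<Longrightarrow> inverse a \<in> K"
    and V_closed: "0 \<in> V" "\<And>x y. x \<in> V \<Longrightarrow> y \<in> V \<Longrightarrow> x + y \<in> V"
      "\<And>a x. a \<in> K \<Longrightarrow> x \<in> V \<Longrightarrow> a * x \<in> V"
    and card_V: "card V = card K ^ n"
begin

abbreviation q :: nat where "q \<equiv> card K"

definition K_subspace :: "'f set \<Rightarrow> bool" where
  "K_subspace U \<longleftrightarrow> U \<subseteq> V \<and> 0 \<in> U \<and> (\<forall>x\<in>U. \<forall>y\<in>U. x + y \<in> U) \<and> (\<forall>a\<in>K. \<forall>x\<in>U. a * x \<in> U)"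

text \<open>For a subspace \<open>U\<close> this is the span of \<open>U\<close> and
  \<open>w\<close>.\<close>

definition extend :: "'f set \<Rightarrow> 'f \<Rightarrow> 'f set" where
  "extend U w = (\<lambda>(u, a). u + a * w) ` (U \<times> K)"

section \<open>Linear algebra by counting\<close>

lemma q_ge_2: "2 \<le> q"
proof -
  have "card {0, 1 :: 'f} \<le> q" using finite_K K_closed by (intro card_mono) auto
  then show ?thesis by simp
qed

lemma subspace_V: "K_subspace V"
  using V_closed by (auto simp: K_subspace_def)

lemma subspace_finite: "K_subspace U \<Longrightarrow> finite U"
  using finite_V finite_subset by (auto simp: K_subspace_def)

lemma subspace_Int: "K_subspace A \<Longrightarrow> K_subspace B \<Longrightarrow> K_subspace (A \<inter> B)"
  by (auto simp: K_subspace_def)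

lemma subspace_diff:
  assumes "K_subspace U" "x \<in> U" "y \<in> U"
  shows "x - y \<in> U"
proof -
  have "-1 * y \<in> U" using assms K_closed(5)[OF K_closed(2)] unfolding K_subspace_def by blast
  then have "x + -1 * y \<in> U" using assms unfolding K_subspace_def by blast
  then show ?thesis by simp
qed

lemma subspace_card_pos: "K_subspace U \<Longrightarrow> 0 < card U"
  using subspace_finite by (auto simp: card_gt_0_iff K_subspace_def)

lemma extend_subset: "K_subspace W \<Longrightarrow> U \<subseteq> W \<Longrightarrow> w \<in> W \<Longrightarrow> extend U w \<subseteq> W"
  by (auto simp: extend_def K_subspace_def)

lemma extend_superset: "U \<subseteq> extend U w"
  using K_closed by (force simp: extend_def)

lemma extend_mem: "K_subspace U \<Longrightarrow> w \<in> extend U w"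
  using K_closed unfolding extend_def K_subspace_def by (intro image_eqI[of _ _ "(0, 1)"]) auto

lemma subspace_extend:
  assumes U: "K_subspace U" and w: "w \<in> V"
  shows "K_subspace (extend U w)"
  unfolding K_subspace_def
proof (intro conjI ballI)
  show "extend U w \<subseteq> V" using U w by (intro extend_subset subspace_V) (auto simp: K_subspace_def)
  show "0 \<in> extend U w" using U extend_superset by (auto simp: K_subspace_def)
next
  fix x y assume "x \<in> extend U w" "y \<in> extend U w"
  then obtain u a v b where uv: "u \<in> U" "v \<in> U" "a \<in> K" "b \<in> K" "x = u + a * w" "y = v + b * w"
    by (auto simp: extend_def)
  then have "x + y = (u + v) + (a + b) * w" by (simp add: algebra_simps)
  moreover have "u + v \<in> U" "a + b \<in> K" using uv U K_closed by (auto simp: K_subspace_def)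
  ultimately show "x + y \<in> extend U w" by (force simp: extend_def)
next
  fix c x assume "c \<in> K" "x \<in> extend U w"
  then obtain u a where ua: "u \<in> U" "a \<in> K" "x = u + a * w" by (auto simp: extend_def)
  then have "c * x = c * u + (c * a) * w" by (simp add: algebra_simps)
  moreover have "c * u \<in> U" "c * a \<in> K"
    using ua U K_closed \<open>c \<in> K\<close> by (auto simp: K_subspace_def)
  ultimately show "c * x \<in> extend U w" by (force simp: extend_def)
qed

lemma card_extend:
  assumes U: "K_subspace U" and w: "w \<notin> U"
  shows "card (extend U w) = card U * q"
proof -
  have "inj_on (\<lambda>(u, a). u + a * w) (U \<times> K)"
  proof (rule inj_onI, clarify)
    fix u a v b assume uv: "u \<in> U" "a \<in> K" "v \<in> U" "b \<in> K" "u + a * w = v + b * w"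
    have "a = b"
    proof (rule ccontr)
      assume "a \<noteq> b"
      then have "w = inverse (a - b) * (v - u)"
        using uv(5) by (simp add: field_simps)
      moreover have "a - b \<in> K" using K_closed(3)[OF uv(2) K_closed(5)[OF uv(4)]] by simp
      then have "inverse (a - b) \<in> K" by (rule K_closed)
      ultimately have "w \<in> U" using subspace_diff[OF U uv(3,1)] U by (auto simp: K_subspace_def)
      then show False using w by simp
    qed
    then show "u = v \<and> a = b" using uv by simp
  qed
  then show ?thesis by (simp add: extend_def card_image card_cartesian_product)
qed

text \<open>The dimension inequality for intersections in multiplicative form: each fibre of the
  difference map from \<open>A \<times> B\<close> to \<open>V\<close> is translated injectively into
  \<open>A \<inter> B\<close> by one of its own points.\<close>

lemma card_Int_ge:
  assumes A: "K_subspace A" and B: "K_subspace B"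
  shows "card A * card B \<le> card (A \<inter> B) * q ^ n"
proof -
  let ?fib = "\<lambda>v. {p \<in> A \<times> B. fst p - snd p = v}"
  note fin = subspace_finite[OF A] subspace_finite[OF B]
  have AV: "A \<subseteq> V" "B \<subseteq> V" using A B by (auto simp: K_subspace_def)
  have "A \<times> B \<subseteq> (\<Union>v\<in>V. ?fib v)"
    using AV by (auto intro!: subspace_diff[OF subspace_V])
  then have "card (A \<times> B) \<le> card (\<Union>v\<in>V. ?fib v)"
    using fin finite_V by (intro card_mono) auto
  also have "\<dots> \<le> (\<Sum>v\<in>V. card (?fib v))" by (rule card_UN_le) (rule finite_V)
  also have "\<dots> \<le> (\<Sum>v\<in>V. card (A \<inter> B))"
  proof (rule sum_mono)
    fix v
    show "card (?fib v) \<le> card (A \<inter> B)"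
    proof (cases "?fib v = {}")
      case False
      then obtain a b where ab: "a \<in> A" "b \<in> B" "a - b = v" by auto
      have "(\<lambda>p. fst p - a) ` ?fib v \<subseteq> A \<inter> B"
      proof (rule image_subsetI)
        fix p assume "p \<in> ?fib v"
        then have p: "fst p \<in> A" "snd p \<in> B" "fst p - snd p = a - b" using ab by auto
        then have "fst p - a = snd p - b" by (simp add: algebra_simps)
        then show "fst p - a \<in> A \<inter> B"
          using subspace_diff[OF A p(1) ab(1)] subspace_diff[OF B p(2) ab(2)] by simp
      qed
      moreover have "inj_on (\<lambda>p. fst p - a) (?fib v)"
        by (rule inj_onI) (auto simp: prod_eq_iff algebra_simps)
      ultimately show ?thesis using fin by (intro card_inj_on_le) auto
    qed (simp only: card.empty le0)
  qed
  also have "\<dots> = card (A \<inter> B) * q ^ n" by (simp add: card_V)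
  finally show ?thesis by (simp add: card_cartesian_product)
qed

text \<open>Dimension is recorded as cardinality, \<open>q ^ i\<close> elements standing for
  dimension \<open>i\<close>.\<close>

definition between :: "'f set \<Rightarrow> 'f set \<Rightarrow> nat \<Rightarrow> 'f set set" where
  "between A B m = {U. K_subspace U \<and> A \<subseteq> U \<and> U \<subseteq> B \<and> card U = m}"

lemma finite_between: "finite (between A B m)"
  by (rule finite_subset[of _ "Pow V"]) (use finite_V in \<open>auto simp: between_def K_subspace_def\<close>)

text \<open>\<open>U\<close> is one dimension above \<open>A\<close>, so any of its vectors outside
  \<open>A\<close> determines it. Hence the sets \<open>U - A\<close> for different \<open>U\<close>
  are disjoint.\<close>

lemma between_eq_extend:
  assumes A: "K_subspace A" and U: "U \<in> between A B (q * card A)" and w: "w \<in> U" "w \<notin> A"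
  shows "U = extend A w"
proof -
  have "extend A w \<subseteq> U" using U w by (intro extend_subset) (auto simp: between_def)
  moreover have "card (extend A w) = card U"
    using card_extend[OF A w(2)] U by (simp add: between_def)
  ultimately show ?thesis
    using U subspace_finite card_subset_eq by (metis (no_types, lifting) between_def mem_Collect_eq)
qed

text \<open>The sets \<open>U - A\<close>, all of the same size, cover \<open>B - A\<close>, since
  each vector outside \<open>A\<close> spans such a \<open>U\<close> together with \<open>A\<close>.
  This bounds the number of flags from below; the disjointness of these sets gives the opposite
  bound, used for degrees.\<close>

lemma card_between_ge:
  assumes A: "K_subspace A" and B: "K_subspace B" and "A \<subseteq> B"
  shows "card B - card A \<le> card (between A B (q * card A)) * (q * card A - card A)"
proof -
  let ?S = "between A B (q * card A)"
  have "B - A \<subseteq> (\<Union>U\<in>?S. U - A)"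
  proof
    fix w assume w: "w \<in> B - A"
    then have "w \<in> V" using B by (auto simp: K_subspace_def)
    then have "extend A w \<in> ?S"
      using w subspace_extend[OF A] extend_superset extend_subset[OF B] card_extend[OF A] assms
      by (auto simp: between_def mult.commute)
    then show "w \<in> (\<Union>U\<in>?S. U - A)" using w extend_mem[OF A] by blast
  qed
  then have "card (B - A) \<le> card (\<Union>U\<in>?S. U - A)"
    by (intro card_mono finite_UN_I finite_between) (auto simp: between_def subspace_finite)
  also have "\<dots> \<le> (\<Sum>U\<in>?S. card (U - A))" by (rule card_UN_le) (rule finite_between)
  also have "\<dots> = (\<Sum>U\<in>?S. q * card A - card A)"
    using subspace_finite[OF A] by (intro sum.cong) (auto simp: between_def card_Diff_subset)
  finally show ?thesis using assms subspace_finite by (simp add: card_Diff_subset)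
qed

lemma card_between_le:
  assumes A: "K_subspace A" and B: "K_subspace B" and "A \<subseteq> B"
  shows "card (between A B (q * card A)) * (q * card A - card A) \<le> card B - card A"
proof -
  let ?S = "between A B (q * card A)"
  have "(\<Sum>U\<in>?S. q * card A - card A) = (\<Sum>U\<in>?S. card (U - A))"
    using subspace_finite[OF A] by (intro sum.cong) (auto simp: between_def card_Diff_subset)
  also have "\<dots> = card (\<Union>U\<in>?S. U - A)"
  proof (rule card_UN_disjoint[symmetric])
    show "\<forall>U\<in>?S. \<forall>U'\<in>?S. U \<noteq> U' \<longrightarrow> (U - A) \<inter> (U' - A) = {}"
      using between_eq_extend[OF A] by blast
  qed (use finite_between in \<open>auto simp: between_def subspace_finite\<close>)
  also have "\<dots> \<le> card (B - A)"
    using subspace_finite[OF B] by (intro card_mono) (auto simp: between_def)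
  finally show ?thesis using assms subspace_finite by (simp add: card_Diff_subset)
qed

text \<open>These subspaces correspond to points of a projective line:
  \<open>(q^2 - 1) / (q - 1) = q + 1\<close>.\<close>

lemma card_between_line:
  assumes "K_subspace A" "K_subspace B" "A \<subseteq> B" "card B = q * (q * card A)"
  shows "card (between A B (q * card A)) \<le> q + 1"
proof -
  have q: "q * card A - card A > 0" using q_ge_2 subspace_card_pos[OF assms(1)] by simp
  have "card B - card A = (q + 1) * (q * card A - card A)"
    using assms(4) by (simp add: algebra_simps diff_mult_distrib2)
  with card_between_le[OF assms(1-3)]
  have "card (between A B (q * card A)) * (q * card A - card A) \<le> (q + 1) * (q * card A - card A)"
    by simp
  then show ?thesis using q by (simp only: mult_le_cancel2)
qed

section \<open>Complete flags and their number\<close>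

text \<open>Truncation at dimension \<open>k\<close> allows counting by induction; the default
  \<open>{}\<close> above \<open>k\<close> makes a flag determined by its subspaces.\<close>

definition flags :: "nat \<Rightarrow> (nat \<Rightarrow> 'f set) set" where
  "flags k = {F. (\<forall>i\<le>k. K_subspace (F i) \<and> card (F i) = q ^ i) \<and> (\<forall>i<k. F i \<subseteq> F (Suc i)) \<and>
     (\<forall>i>k. F i = {})}"

lemma flagsD:
  assumes "F \<in> flags k"
  shows "i \<le> k \<Longrightarrow> K_subspace (F i)" "i \<le> k \<Longrightarrow> card (F i) = q ^ i" "i < k \<Longrightarrow> F i \<subseteq> F (Suc i)"
    "i > k \<Longrightarrow> F i = {}"
  using assms by (auto simp: flags_def)

lemma flag_mono:
  assumes "F \<in> flags k" "i \<le> j" "j \<le> k"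
  shows "F i \<subseteq> F j"
  using assms(2,3)
proof (induction j rule: dec_induct)
  case (step j)
  then show ?case using flagsD(3)[OF assms(1), of j] by simp
qed simp

lemma flag_top: "F \<in> flags n \<Longrightarrow> F n = V"
  using flagsD(1,2)[of F n n] card_V card_subset_eq[OF finite_V, of "F n"] by (simp add: K_subspace_def)

lemma finite_flags: "finite (flags k)"
proof (rule finite_subset)
  show "finite {F. \<forall>i. (i \<in> {..k} \<longrightarrow> F i \<in> Pow V) \<and> (i \<notin> {..k} \<longrightarrow> F i = {})}"
    using finite_V by (intro finite_set_of_finite_funs) auto
qed (auto simp: flags_def K_subspace_def)

text \<open>A flag truncated at \<open>k < n\<close> extends by one dimension in at least
  \<open>(q^n - q^k) / (q^(k+1) - q^k)\<close> ways, which is at least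
  \<open>q ^ (n - 1 - k)\<close> because \<open>k \<le> n - 1\<close>.\<close>

lemma card_flags_ge:
  assumes "k \<le> n"
  shows "q ^ (\<Sum>i<k. n - 1 - i) \<le> card (flags k)"
  using assms
proof (induction k)
  case 0
  have "K_subspace {0}" using V_closed by (auto simp: K_subspace_def)
  then have "(\<lambda>i. if i = 0 then {0} else {}) \<in> flags 0" by (auto simp: flags_def)
  then have "0 < card (flags 0)" using finite_flags by (auto simp: card_gt_0_iff)
  then show ?case by simp
next
  case (Suc k)
  let ?B = "\<lambda>F. between (F k) V (q * card (F k))"
  have ext: "q ^ (n - 1 - k) \<le> card (?B F)" if F: "F \<in> flags k" for F
  proof -
    have Fk: "K_subspace (F k)" "card (F k) = q ^ k" using flagsD[OF F] by auto
    have "q ^ (n - 1 - k) * (q * q ^ k - q ^ k) = q ^ n - q ^ (n - 1)"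
    proof -
      have "q ^ (n - 1 - k) * q ^ k = q ^ (n - 1)" "q * q ^ (n - 1) = q ^ n"
        using Suc.prems by (simp_all flip: power_add power_Suc)
      then show ?thesis by (simp add: diff_mult_distrib2 mult.left_commute)
    qed
    also have "\<dots> \<le> q ^ n - q ^ k"
      using q_ge_2 Suc.prems by (intro diff_le_mono2 power_increasing) auto
    also have "\<dots> \<le> card (?B F) * (q * q ^ k - q ^ k)"
      using card_between_ge[OF Fk(1) subspace_V] Fk card_V by (auto simp: K_subspace_def)
    finally show ?thesis using q_ge_2 by simp
  qed
  have inj: "inj_on (\<lambda>(F, U). F(Suc k := U)) (Sigma (flags k) ?B)"
  proof (rule inj_onI, clarify)
    fix F U F' U' assume *: "F \<in> flags k" "F' \<in> flags k" "F(Suc k := U) = F'(Suc k := U')"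
    \<comment> \<open>At \<open>Suc k\<close>, where the update hides the old value, both flags have
      the default \<open>{}\<close>.\<close>
    have "F i = F' i" for i
      using fun_cong[OF *(3), of i] flagsD(4)[OF *(1), of i] flagsD(4)[OF *(2), of i]
      by (cases "i = Suc k") auto
    then show "F = F' \<and> U = U'" using fun_cong[OF *(3), of "Suc k"] by auto
  qed
  have sub: "(\<lambda>(F, U). F(Suc k := U)) ` Sigma (flags k) ?B \<subseteq> flags (Suc k)"
    by (auto simp: flags_def between_def le_Suc_eq less_Suc_eq) blast
  have "q ^ (\<Sum>i<Suc k. n - 1 - i) = q ^ (\<Sum>i<k. n - 1 - i) * q ^ (n - 1 - k)"
    by (simp add: power_add)
  also have "\<dots> \<le> card (flags k) * q ^ (n - 1 - k)" using Suc by simp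
  also have "\<dots> \<le> (\<Sum>F\<in>flags k. card (?B F))"
    using sum_mono[OF ext, of "flags k"] by simp
  also have "\<dots> = card (Sigma (flags k) ?B)"
    using finite_flags finite_between by (subst card_SigmaI) auto
  also have "\<dots> \<le> card (flags (Suc k))"
    by (rule card_inj_on_le[OF inj sub finite_flags])
  finally show ?case .
qed

section \<open>Sorting one flag into another\<close>

text \<open>The K_subspace \<open>U\<close> plays the role of a comparator in a sorting network: for every \<open>j\<close> at once,
  it meets \<open>G j\<close> in the largest dimension that its two neighbours allow.\<close>

lemma exchange:
  assumes F: "F \<in> flags n" and G: "G \<in> flags n" and i: "Suc i < n"
  obtains U where "U \<in> between (F i) (F (Suc (Suc i))) (q ^ Suc i)"
    "\<And>j. j \<le> n \<Longrightarrow> min (q * card (F i \<inter> G j)) (card (F (Suc (Suc i)) \<inter> G j)) \<le> card (U \<inter> G j)"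
proof -
  let ?A = "F i" and ?B = "F (Suc (Suc i))"
  have A: "K_subspace ?A" "card ?A = q ^ i" and B: "K_subspace ?B" "card ?B = q ^ Suc (Suc i)"
    using flagsD[OF F] i by auto
  have AB: "?A \<subseteq> ?B" using flag_mono[OF F] i by simp
  have "\<not> ?B \<inter> G n \<subseteq> ?A"
  proof
    assume "?B \<inter> G n \<subseteq> ?A"
    then have "?B \<subseteq> ?A" using flag_top[OF G] B(1) by (auto simp: K_subspace_def)
    then have "card ?B \<le> card ?A" using subspace_finite[OF A(1)] by (intro card_mono) auto
    moreover have "q ^ i < q ^ Suc (Suc i)" using q_ge_2 by (intro power_strict_increasing) auto
    ultimately show False using A B by simp
  qed
  \<comment> \<open>\<open>m\<close> is the first index at which \<open>G m\<close> meets
    \<open>?B\<close> outside \<open>?A\<close>, and one vector \<open>w\<close> found there serves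
    all \<open>j\<close>: for \<open>j < m\<close> all of \<open>?B \<inter> G j\<close> already
    lies in \<open>?A\<close>, and for \<open>j \<ge> m\<close> the vector \<open>w\<close> lies in
    \<open>G j\<close> and adds a dimension.\<close>
  then obtain m where m: "\<not> ?B \<inter> G m \<subseteq> ?A" "\<And>j. j < m \<Longrightarrow> ?B \<inter> G j \<subseteq> ?A"
    using exists_least_iff[of "\<lambda>j. \<not> ?B \<inter> G j \<subseteq> ?A"] by blast
  then have "m \<le> n" using \<open>\<not> ?B \<inter> G n \<subseteq> ?A\<close> not_less by blast
  from m obtain w where w: "w \<in> ?B" "w \<in> G m" "w \<notin> ?A" by auto
  have wV: "w \<in> V" using w(1) B(1) by (auto simp: K_subspace_def)
  show thesis
  proof (rule that)
    show "extend ?A w \<in> between ?A ?B (q ^ Suc i)"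
      using subspace_extend[OF A(1) wV] extend_superset extend_subset[OF B(1) AB w(1)]
        card_extend[OF A(1) w(3)] A(2) by (auto simp: between_def)
  next
    fix j assume j: "j \<le> n"
    have Gj: "K_subspace (G j)" using flagsD[OF G] j by simp
    have fin: "finite (extend ?A w \<inter> G j)" using subspace_finite[OF Gj] by simp
    show "min (q * card (?A \<inter> G j)) (card (?B \<inter> G j)) \<le> card (extend ?A w \<inter> G j)"
    proof (cases "j < m")
      case True
      then have "?B \<inter> G j \<subseteq> extend ?A w \<inter> G j" using m(2) extend_superset by blast
      then show ?thesis using card_mono[OF fin] by (simp add: min.coboundedI2)
    next
      case False
      then have wj: "w \<in> G j" using flag_mono[OF G _ j, of m] w(2) by auto
      have "extend (?A \<inter> G j) w \<subseteq> G j" using extend_subset[OF Gj] wj by blast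
      moreover have "extend (?A \<inter> G j) w \<subseteq> extend ?A w" by (auto simp: extend_def)
      moreover have "card (extend (?A \<inter> G j) w) = q * card (?A \<inter> G j)"
        using card_extend[OF subspace_Int[OF A(1) Gj]] w(3) by simp
      ultimately show ?thesis using card_mono[OF fin, of "extend (?A \<inter> G j) w"] by auto
    qed
  qed
qed

text \<open>Odd-even transposition sort sorts \<open>n\<close> items in \<open>n\<close> rounds. In round \<open>t\<close> the \<open>i\<close>-th subspaces
  with \<open>i + t + s\<close> odd are replaced, and \<open>bound s t i j\<close> is a lower bound for the dimension of the
  intersection of the \<open>i\<close>-th K_subspace with \<open>G j\<close> before that round.\<close>

definition bound :: "nat \<Rightarrow> nat \<Rightarrow> nat \<Rightarrow> nat \<Rightarrow> nat" where
  "bound s t i j = min i (min j ((i + j + t + (if even (i + t + s) then 1 else 0) - n) div 2))"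

text \<open>The parity term in \<open>bound\<close> is tuned to the round: at a kept index the bound
  is the same before and after, and at a replaced index \<open>i\<close> the new bound is at most
  one more than the old one at \<open>i - 1\<close> and at most the old one at \<open>i + 1\<close>,
  which is what \<open>exchange\<close> delivers. Indices 0 and \<open>n\<close> are treated
  directly.\<close>

lemma sorting_round:
  assumes F: "F \<in> flags n" and G: "G \<in> flags n"
    and bnd: "\<And>i j. i \<le> n \<Longrightarrow> j \<le> n \<Longrightarrow> q ^ bound s t i j \<le> card (F i \<inter> G j)"
  obtains F' where "F' \<in> flags n" "\<And>i. even (i + t + s) \<Longrightarrow> F' i = F i"
    "\<And>i j. i \<le> n \<Longrightarrow> j \<le> n \<Longrightarrow> q ^ bound s (Suc t) i j \<le> card (F' i \<inter> G j)"
proof -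
  have "\<forall>i. \<exists>U. Suc i < n \<longrightarrow> U \<in> between (F i) (F (Suc (Suc i))) (q ^ Suc i) \<and>
    (\<forall>j\<le>n. min (q * card (F i \<inter> G j)) (card (F (Suc (Suc i)) \<inter> G j)) \<le> card (U \<inter> G j))"
    using exchange[OF F G] by metis
  then obtain U where U: "\<And>i. Suc i < n \<Longrightarrow> U i \<in> between (F i) (F (Suc (Suc i))) (q ^ Suc i)"
    "\<And>i j. Suc i < n \<Longrightarrow> j \<le> n \<Longrightarrow>
      min (q * card (F i \<inter> G j)) (card (F (Suc (Suc i)) \<inter> G j)) \<le> card (U i \<inter> G j)"
    by metis
  \<comment> \<open>\<open>U\<close> is indexed by its lower neighbour, hence the shift. Only one
    parity changes, so the neighbours enclosing a new subspace stay in place.\<close>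
  define F' where "F' i = (if 0 < i \<and> i < n \<and> odd (i + t + s) then U (i - 1) else F i)" for i
  have U': "U (i - 1) \<in> between (F (i - 1)) (F (Suc i)) (q ^ i)" if "0 < i" "i < n" for i
    using U(1)[of "i - 1"] that by simp
  show thesis
  proof (rule that)
    show "F' \<in> flags n"
      unfolding flags_def
    proof (intro CollectI conjI allI impI)
      fix i assume "i \<le> n"
      then show "K_subspace (F' i)" "card (F' i) = q ^ i"
        using U'[of i] flagsD(1,2)[OF F, of i] by (auto simp: F'_def between_def)
    next
      fix i assume "i < n"
      then show "F' i \<subseteq> F' (Suc i)"
        using U'[of i] U'[of "Suc i"] flagsD(3)[OF F, of i] by (auto simp: F'_def between_def)
    next
      fix i assume "i > n"
      then show "F' i = {}" using flagsD(4)[OF F] by (auto simp: F'_def)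
    qed
  next
    fix i assume "even (i + t + s)"
    then show "F' i = F i" by (simp add: F'_def)
  next
    fix i j assume ij: "i \<le> n" "j \<le> n"
    have q1: "1 \<le> q" using q_ge_2 by simp
    consider "i = 0" | "i = n" | "0 < i" "i < n" "odd (i + t + s)" | "even (i + t + s)"
      using ij by linarith
    then show "q ^ bound s (Suc t) i j \<le> card (F' i \<inter> G j)"
    proof cases
      case 1
      have "K_subspace (F 0 \<inter> G j)" using flagsD(1)[OF F] flagsD(1)[OF G] ij by (intro subspace_Int) auto
      then show ?thesis using 1 subspace_card_pos by (fastforce simp: bound_def F'_def)
    next
      case 2
      have "F n \<inter> G j = G j" using flag_top[OF F] flagsD(1)[OF G, of j] ij by (auto simp: K_subspace_def)
      then have "card (F' i \<inter> G j) = q ^ j" using 2 flagsD(2)[OF G, of j] ij by (simp add: F'_def)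
      moreover have "bound s (Suc t) i j \<le> j" by (simp add: bound_def)
      ultimately show ?thesis using power_increasing q1 by metis
    next
      case 3
      have "bound s (Suc t) i j \<le> Suc (bound s t (i - 1) j)"
      proof -
        \<comment> \<open>Subtraction is truncated: \<open>x + 2 - n\<close> can be smaller than
          \<open>x - n + 2\<close>.\<close>
        have half: "(x + 2 - n) div 2 \<le> Suc ((x - n) div 2)" for x
        proof -
          have "(x + 2 - n) div 2 \<le> (x - n + 2) div 2" by (intro div_le_mono) simp
          then show ?thesis by simp
        qed
        obtain k where "i = Suc k" using 3 by (cases i) auto
        then show ?thesis using 3 half[of "Suc (k + j + t)"] by (auto simp: bound_def min_def)
      qed
      then have "q ^ bound s (Suc t) i j \<le> q * q ^ bound s t (i - 1) j"
        using power_increasing[of _ _ q] q1 by (metis power_Suc)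
      also have "\<dots> \<le> q * card (F (i - 1) \<inter> G j)" using bnd[of "i - 1" j] ij by simp
      finally have 1: "q ^ bound s (Suc t) i j \<le> q * card (F (i - 1) \<inter> G j)" .
      have "bound s (Suc t) i j \<le> bound s t (Suc i) j"
        using 3 unfolding bound_def by (auto simp: min_def)
      then have "q ^ bound s (Suc t) i j \<le> q ^ bound s t (Suc i) j"
        using power_increasing q1 by metis
      also have "\<dots> \<le> card (F (Suc i) \<inter> G j)" using bnd[of "Suc i" j] ij 3 by simp
      finally show ?thesis using 1 U(2)[of "i - 1" j] 3 ij by (simp add: F'_def)
    next
      case 4
      then have "bound s (Suc t) i j = bound s t i j" by (simp add: bound_def)
      then show ?thesis using 4 bnd[OF ij] by (simp add: F'_def)
    qed
  qed
qed

text \<open>The dimension inequality gives the bound before the first round; after \<open>n\<close>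
  rounds it forces the \<open>i\<close>-th subspace to coincide with \<open>G i\<close>. The parity
  \<open>s\<close> selects the side kept first.\<close>

lemma sorting_chain:
  assumes F: "F \<in> flags n" and G: "G \<in> flags n"
  obtains c where "c 0 = F" "c n = G" "\<And>t. c t \<in> flags n"
    "\<And>t i. even (i + t + s) \<Longrightarrow> c t i = c (Suc t) i"
proof -
  let ?inv = "\<lambda>t F'. \<forall>i\<le>n. \<forall>j\<le>n. q ^ bound s t i j \<le> card (F' i \<inter> G j)"
  have init: "?inv 0 F"
  proof (intro allI impI)
    fix i j assume ij: "i \<le> n" "j \<le> n"
    note sub = flagsD(1)[OF F ij(1)] flagsD(1)[OF G ij(2)]
    have pos: "0 < card (F i \<inter> G j)" using subspace_card_pos subspace_Int sub by blast
    have *: "q ^ (i + j) \<le> card (F i \<inter> G j) * q ^ n"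
      using card_Int_ge[OF sub] flagsD(2)[OF F ij(1)] flagsD(2)[OF G ij(2)] by (simp add: power_add)
    have "q ^ (i + j - n) \<le> card (F i \<inter> G j)"
    proof (cases "n \<le> i + j")
      case True
      then have "q ^ (i + j) = q ^ (i + j - n) * q ^ n" by (simp flip: power_add)
      then show ?thesis using * q_ge_2 by simp
    qed (use pos in simp)
    \<comment> \<open>Halving outweighs the parity term:
      \<open>(x + 1) div 2 \<le> x\<close>.\<close>
    moreover have "bound s 0 i j \<le> i + j - n" by (auto simp: bound_def)
    then have "q ^ bound s 0 i j \<le> q ^ (i + j - n)" using q_ge_2 by (intro power_increasing) auto
    ultimately show "q ^ bound s 0 i j \<le> card (F i \<inter> G j)" by linarith
  qed
  have "\<exists>c. \<forall>t. (c t \<in> flags n \<and> ?inv t (c t) \<and> (t = 0 \<longrightarrow> c t = F)) \<and>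
      (\<forall>i. even (i + t + s) \<longrightarrow> c (Suc t) i = c t i)"
  proof (rule dependent_nat_choice)
    show "\<exists>F'. F' \<in> flags n \<and> ?inv 0 F' \<and> (0 = (0::nat) \<longrightarrow> F' = F)" using F init by blast
  next
    fix F' t assume "F' \<in> flags n \<and> ?inv t F' \<and> (t = 0 \<longrightarrow> F' = F)"
    then obtain F'' where "F'' \<in> flags n" "\<And>i. even (i + t + s) \<Longrightarrow> F'' i = F' i"
      "\<And>i j. i \<le> n \<Longrightarrow> j \<le> n \<Longrightarrow> q ^ bound s (Suc t) i j \<le> card (F'' i \<inter> G j)"
      using sorting_round[OF _ G, of F' s t] by blast
    then show "\<exists>F''. (F'' \<in> flags n \<and> ?inv (Suc t) F'' \<and> (Suc t = 0 \<longrightarrow> F'' = F)) \<and>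
        (\<forall>i. even (i + t + s) \<longrightarrow> F'' i = F' i)" by blast
  qed
  then obtain c where c: "\<And>t. c t \<in> flags n" "\<And>t. ?inv t (c t)" "c 0 = F"
    "\<And>t i. even (i + t + s) \<Longrightarrow> c (Suc t) i = c t i" by blast
  have "c n i = G i" for i
  proof (cases "i \<le> n")
    case True
    \<comment> \<open>For \<open>t = n\<close> and \<open>j = i\<close> the halved term is at least
      \<open>i\<close>.\<close>
    have "bound s n i i = i" by (auto simp: bound_def)
    then have "q ^ i \<le> card (c n i \<inter> G i)" using c(2)[of n] True by metis
    moreover have fin: "finite (c n i)" "finite (G i)" and card: "card (c n i) = q ^ i" "card (G i) = q ^ i"
      using flagsD(1,2)[OF c(1), of i] flagsD(1,2)[OF G, of i] True subspace_finite by auto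
    ultimately have "c n i \<inter> G i = c n i" "c n i \<inter> G i = G i"
      by (metis Int_lower1 card_seteq) (metis Int_lower2 card_seteq fin(2) card(2) \<open>q ^ i \<le> _\<close>)
    then show ?thesis by simp
  qed (use flagsD(4)[OF G] flagsD(4)[OF c(1)] in simp)
  then have "c n = G" by auto
  then show thesis using that[of c] c by simp
qed

section \<open>The chamber system of flags\<close>

text \<open>The default \<open>{}\<close> erases one parity class, so equal projections mean
  agreement on the other class.\<close>

definition proj :: "nat \<Rightarrow> (nat \<Rightarrow> 'f set) \<Rightarrow> nat \<Rightarrow> 'f set" where
  "proj s F = (\<lambda>i. if even (i + s) then F i else {})"

lemma proj_eq_iff: "proj s F = proj s G \<longleftrightarrow> (\<forall>i. even (i + s) \<longrightarrow> F i = G i)"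
  by (auto simp: proj_def fun_eq_iff)

text \<open>Flags with the same projection agree at 0 and \<open>n\<close> and at every index of the
  kept parity. Each remaining subspace lies between two fixed neighbours two dimensions apart, which
  leaves at most \<open>q + 1\<close> choices.\<close>

lemma proj_fibre_card:
  assumes F: "F \<in> flags n"
  shows "card {G \<in> flags n. proj s G = proj s F} \<le> (q + 1) ^ card {i \<in> {0<..<n}. odd (i + s)}"
proof -
  let ?I = "{i \<in> {0<..<n}. odd (i + s)}"
  let ?B = "\<lambda>i. between (F (i - 1)) (F (Suc i)) (q * card (F (i - 1)))"
  have fixed: "G i = F i" if G: "G \<in> flags n" "proj s G = proj s F" "i \<notin> ?I" for G i
  proof -
    consider "i = 0" | "i = n" | "i > n" | "even (i + s)" using G(3) by fastforce
    then show ?thesis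
    proof cases
      case 1
      have H0: "H 0 = {0}" if "H \<in> flags n" for H
        using flagsD(1,2)[OF that, of 0] by (auto simp: K_subspace_def card_1_singleton_iff)
      then show ?thesis using 1 H0[OF F] H0[OF G(1)] by simp
    qed (use G flag_top[OF F] flag_top[of G] flagsD(4)[OF F] flagsD(4)[of G] proj_eq_iff in auto)
  qed
  have inj: "inj_on (\<lambda>G. restrict G ?I) {G \<in> flags n. proj s G = proj s F}"
  proof (rule inj_onI)
    fix G H assume GH: "G \<in> {G \<in> flags n. proj s G = proj s F}"
      "H \<in> {G \<in> flags n. proj s G = proj s F}" "restrict G ?I = restrict H ?I"
    have "G i = H i" for i
      using fun_cong[OF GH(3), of i] fixed[of G i] fixed[of H i] GH(1,2)
      by (cases "i \<in> ?I") (auto simp: restrict_def)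
    then show "G = H" by auto
  qed
  have sub: "(\<lambda>G. restrict G ?I) ` {G \<in> flags n. proj s G = proj s F} \<subseteq> PiE ?I ?B"
  proof (rule image_subsetI, rule PiE_I)
    fix G i assume G: "G \<in> {G \<in> flags n. proj s G = proj s F}" and i: "i \<in> ?I"
    have "G (i - 1) = F (i - 1)" "G (Suc i) = F (Suc i)" using G i by (auto simp: proj_eq_iff)
    moreover have "q * card (F (i - 1)) = q ^ i"
      using i flagsD(2)[OF F, of "i - 1"] by (cases i) auto
    ultimately show "restrict G ?I i \<in> ?B i"
      using G i flagsD[of G n i] flag_mono[of G n "i - 1" i] flag_mono[of G n i "Suc i"]
      by (auto simp: between_def)
  qed (auto simp: restrict_def)
  have "card {G \<in> flags n. proj s G = proj s F} \<le> card (PiE ?I ?B)"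
    using card_inj_on_le[OF inj sub] finite_between by (simp add: finite_PiE)
  also have "\<dots> = (\<Prod>i\<in>?I. card (?B i))" by (rule card_PiE) simp
  also have "\<dots> \<le> (\<Prod>i\<in>?I. q + 1)"
  proof (intro prod_mono conjI card_between_line)
    fix i assume i: "i \<in> ?I"
    then obtain k where k: "i = Suc k" "Suc k < n" by (cases i) auto
    then show "K_subspace (F (i - 1))" "K_subspace (F (Suc i))" "F (i - 1) \<subseteq> F (Suc i)"
      "card (F (Suc i)) = q * (q * card (F (i - 1)))"
      using flagsD(1,2)[OF F] flag_mono[OF F] by auto
  qed simp
  finally show ?thesis by simp
qed

lemma chamber_system_flags:
  "chamber_system n (flags n) (proj 0) (proj 1)
     ((q + 1) ^ card {i \<in> {0<..<n}. odd i}) ((q + 1) ^ card {i \<in> {0<..<n}. even i})"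
  unfolding chamber_system_def
proof (intro conjI ballI)
  show "inj_on (\<lambda>F. (proj 0 F, proj 1 F)) (flags n)"
    by (rule inj_onI) (auto simp: proj_eq_iff)
next
  fix F assume F: "F \<in> flags n"
  show "card {G \<in> flags n. proj 0 G = proj 0 F} \<le> (q + 1) ^ card {i \<in> {0<..<n}. odd i}"
    using proj_fibre_card[OF F, of 0] by simp
  show "card {G \<in> flags n. proj 1 G = proj 1 F} \<le> (q + 1) ^ card {i \<in> {0<..<n}. even i}"
    using proj_fibre_card[OF F, of 1] by simp
next
  fix F G assume FG: "F \<in> flags n" "G \<in> flags n"
  from sorting_chain[OF FG, of 0]
  obtain c where "c 0 = F" "c n = G" "\<And>t. c t \<in> flags n"
    "\<And>t i. even (i + t + 0) \<Longrightarrow> c t i = c (Suc t) i" by blast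
  then show "alternating_chain (flags n) (proj 0) (proj 1) n F G"
    unfolding alternating_chain_def by (intro exI[of _ c]) (auto simp: proj_eq_iff)
  from sorting_chain[OF FG, of 1]
  obtain c where "c 0 = F" "c n = G" "\<And>t. c t \<in> flags n"
    "\<And>t i. even (i + t + 1) \<Longrightarrow> c t i = c (Suc t) i" by blast
  then show "alternating_chain (flags n) (proj 1) (proj 0) n F G"
    unfolding alternating_chain_def by (intro exI[of _ c]) (auto simp: proj_eq_iff)
qed (rule finite_flags)

text \<open>The two sides of the bipartite graph of flags have different degrees if \<open>n\<close> is even. Taking the
  product with the swapped system balances them.\<close>

lemma chamber_system_flag_pairs:
  "chamber_system n (flags n \<times> flags n) (map_prod (proj 0) (proj 1)) (map_prod (proj 1) (proj 0))
     ((q + 1) ^ (n - 1)) ((q + 1) ^ (n - 1))"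
proof -
  have "card {i \<in> {0<..<n}. odd i} + card {i \<in> {0<..<n}. even i} =
      card ({i \<in> {0<..<n}. odd i} \<union> {i \<in> {0<..<n}. even i})"
    by (rule card_Un_disjoint[symmetric]) auto
  also have "{i \<in> {0<..<n}. odd i} \<union> {i \<in> {0<..<n}. even i} = {0<..<n}" by auto
  finally have "card {i \<in> {0<..<n}. odd i} + card {i \<in> {0<..<n}. even i} = n - 1" by simp
  then show ?thesis
    using chamber_system_prod[OF chamber_system_flags chamber_system_swap[OF chamber_system_flags]]
    by (simp add: add.commute flip: power_add)
qed

lemma card_flag_pairs_ge: "q ^ (n * (n - 1)) \<le> card (flags n \<times> flags n)"
proof -
  have "(\<Sum>i<n. n - 1 - i) = (\<Sum>i<n. i)"
    using sum.nat_diff_reindex[of "\<lambda>i. i" n] by simp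
  then have "2 * (\<Sum>i<n. n - 1 - i) = n * (n - 1)"
    using dvd_mult_div_cancel[of 2 "n * (n - 1)"] by (cases n) (simp_all add: lessThan_atLeast0 Sum_Ico_nat)
  then have "q ^ (n * (n - 1)) = q ^ (\<Sum>i<n. n - 1 - i) * q ^ (\<Sum>i<n. n - 1 - i)"
    by (simp flip: power_add mult_2)
  also have "\<dots> \<le> card (flags n) * card (flags n)" using card_flags_ge by (intro mult_mono) auto
  finally show ?thesis by (simp add: card_cartesian_product)
qed

end

section \<open>Finite fields\<close>

text \<open>A root at which the derivative does not vanish is simple, so splitting off its linear
  factor removes exactly one root and leaves a polynomial of the same kind.\<close>

lemma card_roots_separable:
  fixes p :: "'a :: alg_closed_field poly"
  assumes "p \<noteq> 0" "\<And>x. poly p x = 0 \<Longrightarrow> poly (pderiv p) x \<noteq> 0"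
  shows "card {x. poly p x = 0} = Polynomial.degree p"
  using assms
proof (induction "Polynomial.degree p" arbitrary: p)
  case 0
  then obtain c where "p = [:c:]" "c \<noteq> 0" by (metis degree_eq_zeroE pCons_eq_0_iff)
  then show ?case by simp
next
  case (Suc n)
  then obtain x where x: "poly p x = 0" using alg_closed_imp_poly_has_root[of p] by auto
  then obtain r where r: "p = [:-x, 1:] * r" by (metis poly_eq_0_iff_dvd dvdE)
  have r0: "r \<noteq> 0" using r Suc.prems by auto
  have pd: "pderiv p = [:-x, 1:] * pderiv r + r" unfolding r pderiv_mult by (simp add: pderiv_pCons)
  have rx: "poly r x \<noteq> 0" using Suc.prems(2)[OF x] by (simp add: pd)
  have deg: "Polynomial.degree p = Suc (Polynomial.degree r)"
    using r0 by (simp add: r degree_mult_eq del: mult_pCons_left)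
  have "poly (pderiv r) y \<noteq> 0" if "poly r y = 0" for y
  proof -
    have "poly p y = 0" using that by (simp add: r)
    then have "poly (pderiv p) y \<noteq> 0" by (rule Suc.prems(2))
    then show ?thesis using that unfolding pd by auto
  qed
  then have "card {y. poly r y = 0} = Polynomial.degree r"
    using Suc.hyps deg r0 by simp
  moreover have "{y. poly p y = 0} = insert x {y. poly r y = 0}" by (auto simp: r)
  ultimately show ?case using rx deg poly_roots_finite[OF r0] by simp
qed

text \<open>These are the roots of \<open>X^(p^m) - X\<close>, whose derivative is the constant -1
  in characteristic \<open>p\<close>.\<close>

lemma card_frobenius_fixed:
  assumes "prime CHAR('a :: alg_closed_field)" "0 < m"
  shows "card {x :: 'a. x ^ (CHAR('a) ^ m) = x} = CHAR('a) ^ m"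
proof -
  let ?q = "CHAR('a) ^ m"
  have q: "1 < ?q" using assms prime_gt_1_nat by (intro one_less_power) auto
  define P :: "'a poly" where "P = monom 1 ?q + [:0, -1:]"
  have deg: "Polynomial.degree P = ?q"
    unfolding P_def using q by (subst degree_add_eq_left) (auto simp: degree_monom_eq)
  have "of_nat ?q = (0 :: 'a)" using assms by (simp add: of_nat_eq_0_iff_char_dvd)
  then have "pderiv P = [:-1:]" by (simp add: P_def pderiv_add pderiv_monom pderiv_pCons)
  then have "card {x. poly P x = 0} = Polynomial.degree P"
    using deg q by (intro card_roots_separable) auto
  moreover have "{x. poly P x = 0} = {x. x ^ ?q = x}" by (auto simp: P_def poly_monom)
  ultimately show ?thesis using deg by simp
qed

text \<open>Inside an algebraically closed field, the field of order \<open>p^(m * n)\<close> is a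
  space over its subfield of order \<open>p^m\<close>. Closure under addition holds because
  Frobenius powers are additive; \<open>sub\<close> is the inclusion of the small field in the large
  one.\<close>

lemma finite_space_frobenius_fixed:
  assumes p: "prime CHAR('a :: alg_closed_field)" and "0 < m" "0 < n"
  shows "finite_space {x :: 'a. x ^ (CHAR('a) ^ m) = x} {x. x ^ (CHAR('a) ^ (m * n)) = x} n"
proof -
  let ?p = "CHAR('a)"
  have card: "card {x :: 'a. x ^ (?p ^ k) = x} = ?p ^ k" if "0 < k" for k
    using card_frobenius_fixed[OF p that] .
  then have fin: "finite {x :: 'a. x ^ (?p ^ k) = x}" if "0 < k" for k
    using that p by (intro card_ge_0_finite) (simp add: prime_gt_0_nat)
  have add: "(x + y) ^ (?p ^ k) = x ^ (?p ^ k) + y ^ (?p ^ k)" for x y :: 'a and k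
    using freshmans_dream'[OF p refl] .
  have pos: "0 < ?p ^ k" for k using p by (simp add: prime_gt_0_nat)
  have neg: "(- x) ^ (?p ^ k) = - (x ^ (?p ^ k))" for x :: 'a and k
    using add[of x "- x" k] pos[of k] by (simp add: eq_neg_iff_add_eq_0 add.commute power_0_left split: if_splits)
  have sub: "x ^ (?p ^ (m * j)) = x" if "x ^ (?p ^ m) = x" for x :: 'a and j
    by (induction j) (simp_all add: that power_add power_mult)
  show ?thesis
    by (unfold_locales)
      (use assms pos fin card in
        \<open>auto simp: add neg sub power_mult_distrib power_inverse power_0_left simp flip: power_mult\<close>)
qed

section \<open>Fields of characteristic 3 and 2\<close>

text \<open>The integers modulo 3, in which 1 and -1 are their own inverses. The algebraic closure
  provides characteristic 3, as that of \<open>bit\<close> provides characteristic 2.\<close>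

datatype gf3 = Zero3 | One3 | Two3

instantiation gf3 :: Fields.field
begin

definition "0 = Zero3"
definition "1 = One3"
definition "- x = (case x of Zero3 \<Rightarrow> Zero3 | One3 \<Rightarrow> Two3 | Two3 \<Rightarrow> One3)"
definition "x + y = (case x of Zero3 \<Rightarrow> y
  | One3 \<Rightarrow> (case y of Zero3 \<Rightarrow> One3 | One3 \<Rightarrow> Two3 | Two3 \<Rightarrow> Zero3)
  | Two3 \<Rightarrow> (case y of Zero3 \<Rightarrow> Two3 | One3 \<Rightarrow> Zero3 | Two3 \<Rightarrow> One3))"
definition "x - y = x + - (y :: gf3)"
definition "x * y = (case x of Zero3 \<Rightarrow> Zero3 | One3 \<Rightarrow> y | Two3 \<Rightarrow> - (y :: gf3))"
definition "inverse x = (x :: gf3)"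
definition "x div y = x * inverse (y :: gf3)"

instance
  by standard
    (auto simp: zero_gf3_def one_gf3_def uminus_gf3_def plus_gf3_def minus_gf3_def times_gf3_def
      inverse_gf3_def divide_gf3_def split: gf3.splits)

end

lemma CHAR_gf3: "CHAR(gf3) = 3"
proof -
  have "of_nat 3 = (0 :: gf3)"
    by (simp add: numeral_3_eq_3 zero_gf3_def one_gf3_def plus_gf3_def)
  then have "CHAR(gf3) dvd 3" by (simp only: of_nat_eq_0_iff_char_dvd)
  moreover have "prime (3 :: nat)" by simp
  ultimately have "CHAR(gf3) = 1 \<or> CHAR(gf3) = 3" unfolding prime_nat_iff by blast
  then show ?thesis by simp
qed

lemma CHAR_bit: "CHAR(bit) = 2"
proof -
  have "of_nat 2 = (0 :: bit)" by simp
  then have "CHAR(bit) dvd 2" by (simp only: of_nat_eq_0_iff_char_dvd)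
  moreover have "prime (2 :: nat)" by simp
  ultimately have "CHAR(bit) = 1 \<or> CHAR(bit) = 2" unfolding prime_nat_iff by blast
  then show ?thesis by simp
qed

text \<open>In the product of the two flag systems, \<open>2 ^ u * 3 ^ v\<close> acts like the order
  of a single field: degrees are about its power \<open>n - 1\<close>, and the number of edges is at
  least its power \<open>n * (n - 1)\<close>.\<close>

lemma h_ge_two_three_powers:
  assumes "0 < u" "0 < v" "0 < n" and d: "((2 ^ u + 1) * (3 ^ v + 1)) ^ (n - 1) \<le> d"
  shows "(2 ^ u * 3 ^ v) ^ (n * (n - 1)) < h n d"
proof -
  let ?K2 = "{x :: bit alg_closure. x ^ (2 ^ u) = x}"
  let ?K3 = "{x :: gf3 alg_closure. x ^ (3 ^ v) = x}"
  interpret F2: finite_space ?K2 "{x. x ^ (2 ^ (u * n)) = x}" n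
    using finite_space_frobenius_fixed[where 'a = "bit alg_closure", of u n] assms
    by (simp add: CHAR_bit)
  interpret F3: finite_space ?K3 "{x. x ^ (3 ^ (v * n)) = x}" n
    using finite_space_frobenius_fixed[where 'a = "gf3 alg_closure", of v n] assms
    by (simp add: CHAR_gf3)
  have q2: "card ?K2 = 2 ^ u"
    using card_frobenius_fixed[where 'a = "bit alg_closure", of u] assms by (simp add: CHAR_bit)
  have q3: "card ?K3 = 3 ^ v"
    using card_frobenius_fixed[where 'a = "gf3 alg_closure", of v] assms by (simp add: CHAR_gf3)
  note sys = chamber_system_prod[OF F2.chamber_system_flag_pairs F3.chamber_system_flag_pairs]
  have "(2 ^ u * 3 ^ v) ^ (n * (n - 1)) \<le> card (F2.flags n \<times> F2.flags n) * card (F3.flags n \<times> F3.flags n)"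
    using F2.card_flag_pairs_ge F3.card_flag_pairs_ge
    unfolding q2 q3 power_mult_distrib by (rule mult_mono) auto
  also have "\<dots> = card ((F2.flags n \<times> F2.flags n) \<times> F3.flags n \<times> F3.flags n)"
    by (simp add: card_cartesian_product)
  also have "\<dots> < h n d"
    by (rule chamber_system_less_h[OF sys]) (use d in \<open>simp_all only: q2 q3 power_mult_distrib\<close>)
  finally show ?thesis .
qed

section \<open>Density of the degrees\<close>

lemma power_bracket:
  fixes \<rho> x y :: real
  assumes "1 < \<rho>" "0 < y" "y \<le> x"
  obtains k where "\<rho> ^ k * y \<le> x" "x < \<rho> ^ Suc k * y"
proof -
  obtain j where "x / y < \<rho> ^ j" using real_arch_pow[OF assms(1)] by blast
  then have "x < \<rho> ^ j * y" using assms by (simp add: field_simps)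
  moreover have "\<not> x < \<rho> ^ 0 * y" using assms by simp
  ultimately obtain k where "\<not> x < \<rho> ^ k * y" "x < \<rho> ^ Suc k * y"
    using ex_least_nat_less[of "\<lambda>k. x < \<rho> ^ k * y" j] by (metis le_refl)
  then show thesis using that[of k] by (simp only: not_less)
qed

lemma two_power_ne_three_power:
  assumes "0 < v"
  shows "(2 :: real) ^ u \<noteq> 3 ^ v"
proof
  assume "(2 :: real) ^ u = 3 ^ v"
  then have "real (2 ^ u) = real (3 ^ v)" by simp
  then have eq: "(2 :: nat) ^ u = 3 ^ v" by (simp only: of_nat_eq_iff)
  show False
  proof (cases u)
    case 0
    then show False using eq assms one_less_power[of "3 :: nat" v] by simp
  next
    case (Suc k)
    then have "even ((2 :: nat) ^ u)" by simp
    then show False unfolding eq by simp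
  qed
qed

text \<open>Dirichlet approximation of \<open>log 2 3\<close> makes
  \<open>t = v * \<theta> - u\<close> small, and \<open>2 powr t\<close> is the ratio of the two
  powers. It is not 1, but the sign of \<open>t\<close> is not controlled, hence the two
  alternatives.\<close>

lemma two_three_ratio:
  fixes e :: real
  assumes "0 < e"
  obtains u v :: nat where "1 < 3 ^ v / (2 :: real) ^ u \<and> 3 ^ v / 2 ^ u < 1 + e \<or>
    1 < 2 ^ u / (3 :: real) ^ v \<and> 2 ^ u / 3 ^ v < 1 + e"
proof -
  define \<theta> where "\<theta> = log 2 3"
  have \<theta>: "1 < \<theta>" "2 powr \<theta> = 3" by (simp_all add: \<theta>_def)
  have "0 < log 2 (1 + e)" using assms by simp
  then obtain N :: nat where N: "0 < N" "1 / N < log 2 (1 + e)"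
    using real_arch_inverse by (metis inverse_eq_divide gr0I)
  obtain h k where hk: "0 < k" "\<bar>of_int k * \<theta> - of_int h\<bar> < 1 / N"
    using Dirichlet_approx[OF N(1)] by metis
  \<comment> \<open>\<open>k * \<theta>\<close> exceeds 1 and the error is below 1, so
    \<open>h\<close> is positive and \<open>nat\<close> loses nothing.\<close>
  have "1 / N \<le> 1" using N by simp
  moreover have "1 < of_int k * \<theta>" using hk(1) \<theta> by (metis less_1_mult mult_le_cancel_right1 of_int_1_le_iff
    less_le_trans not_less int_one_le_iff_zero_less)
  ultimately have "0 < h" using hk(2) by linarith
  define u v where "u = nat h" and "v = nat k"
  define t where "t = v * \<theta> - u"
  have t: "\<bar>t\<bar> < log 2 (1 + e)" using hk N \<open>0 < h\<close> by (simp add: t_def u_def v_def)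
  have "2 powr t = 2 powr (\<theta> * v) / 2 powr u"
    by (simp add: t_def powr_diff mult.commute)
  also have "2 powr (\<theta> * v) = 3 ^ v" by (simp add: powr_realpow \<theta>(2) flip: powr_powr)
  finally have *: "2 powr t = 3 ^ v / 2 ^ u" by (simp add: powr_realpow)
  then have **: "2 powr (- t) = 2 ^ u / 3 ^ v" by (simp add: powr_minus_divide)
  have "t \<noteq> 0" using * two_power_ne_three_power[of v u] hk(1) by (auto simp: v_def)
  have lt: "2 powr s < 1 + e" if "s < log 2 (1 + e)" for s
    using that assms by (simp add: less_log_iff)
  show thesis
  proof (cases "0 < t")
    case True
    then have "1 < 2 powr t" "2 powr t < 1 + e" using lt t by auto
    then show thesis using that * by metis
  next
    case False
    then have "1 < 2 powr (- t)" "2 powr (- t) < 1 + e" using lt t \<open>t \<noteq> 0\<close> by auto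
    then show thesis using that ** by metis
  qed
qed

text \<open>A power of 2 times a fixed power of 3 approximates \<open>x\<close> up to a factor 2.
  Then steps of ratio \<open>\<rho>\<close> close to 1, each trading factors 2 for factors 3 or
  conversely, refine the approximation.\<close>

lemma two_three_dense:
  fixes e :: real
  assumes e: "0 < e"
  obtains x0 where "\<And>x. x0 \<le> x \<Longrightarrow>
    \<exists>a\<ge>A. \<exists>b\<ge>A. 2 ^ a * 3 ^ b \<le> x \<and> x < (1 + e) * (2 ^ a * 3 ^ b)"
proof -
  obtain u v :: nat where uv: "1 < 3 ^ v / (2 :: real) ^ u \<and> 3 ^ v / 2 ^ u < 1 + e \<or>
    1 < 2 ^ u / (3 :: real) ^ v \<and> 2 ^ u / 3 ^ v < 1 + e"
    using two_three_ratio[OF e] by blast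
  define \<rho> :: real where "\<rho> = (if 1 < 3 ^ v / (2 :: real) ^ u then 3 ^ v / 2 ^ u else 2 ^ u / 3 ^ v)"
  have \<rho>: "1 < \<rho>" "\<rho> < 1 + e" using uv by (auto simp: \<rho>_def field_simps)
  \<comment> \<open>As \<open>\<rho> ^ K\<close> exceeds 2, fewer than \<open>K\<close> steps bridge
    the factor 2, whatever the size of \<open>x\<close>.\<close>
  obtain K where K: "2 < \<rho> ^ K" using real_arch_pow[OF \<rho>(1)] by blast
  have fine: "\<exists>k\<le>K. \<rho> ^ k * y \<le> x \<and> x < (1 + e) * (\<rho> ^ k * y)" if y: "0 < y" "y \<le> x" "x < 2 * y" for x y
  proof -
    obtain k where k: "\<rho> ^ k * y \<le> x" "x < \<rho> ^ Suc k * y" using power_bracket[OF \<rho>(1) y(1,2)] .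
    have "2 * y < \<rho> ^ K * y" using K y(1) by (rule mult_strict_right_mono)
    then have "\<rho> ^ k * y < \<rho> ^ K * y" using k(1) y(3) by linarith
    then have "\<rho> ^ k < \<rho> ^ K" using y(1) by simp
    then have "k \<le> K" using \<rho>(1) by (simp add: power_strict_increasing_iff)
    moreover have "\<rho> ^ Suc k * y \<le> (1 + e) * (\<rho> ^ k * y)" using \<rho> y(1) by (simp add: mult_right_mono)
    ultimately show ?thesis using k by fastforce
  qed
  have coarse: "\<exists>a\<ge>B. 2 ^ a * c \<le> x \<and> x < 2 * (2 ^ a * c)" if c: "0 < c" "2 ^ B * c \<le> x" for B and c x :: real
  proof -
    obtain k where "2 ^ k * (2 ^ B * c) \<le> x" "x < 2 ^ Suc k * (2 ^ B * c)"
      using power_bracket[of 2 "2 ^ B * c" x] c by auto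
    then show ?thesis by (intro exI[of _ "k + B"]) (simp add: power_add mult.assoc)
  qed
  show thesis
  proof (cases "1 < 3 ^ v / (2 :: real) ^ u")
    case True
    \<comment> \<open>Each step consumes \<open>u\<close> factors 2, so a reserve of
      \<open>u * K\<close> of them keeps their exponent at least \<open>A\<close>.\<close>
    show thesis
    proof (rule that[of "2 ^ (A + u * K) * 3 ^ A"])
      fix x :: real assume "2 ^ (A + u * K) * 3 ^ A \<le> x"
      then obtain a where a: "A + u * K \<le> a" "2 ^ a * 3 ^ A \<le> x" "x < 2 * (2 ^ a * 3 ^ A)"
        using coarse[of "3 ^ A"] by auto
      obtain k where k: "k \<le> K" "\<rho> ^ k * (2 ^ a * 3 ^ A) \<le> x" "x < (1 + e) * (\<rho> ^ k * (2 ^ a * 3 ^ A))"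
        using fine[OF _ a(2,3)] by auto
      have "u * k \<le> u * K" using k(1) by simp
      then have ak: "A \<le> a - u * k" "a = (a - u * k) + u * k" using a(1) by linarith+
      have \<rho>k: "\<rho> ^ k * 2 ^ (u * k) = 3 ^ (v * k)"
        using True by (simp add: \<rho>_def power_divide power_mult)
      have "(2 :: real) ^ a = 2 ^ (a - u * k) * 2 ^ (u * k)" using ak(2) by (metis power_add)
      then have "\<rho> ^ k * (2 ^ a * 3 ^ A) = 2 ^ (a - u * k) * (3 ^ A * (\<rho> ^ k * 2 ^ (u * k)))"
        by (simp only: mult_ac)
      also have "\<dots> = 2 ^ (a - u * k) * 3 ^ (A + v * k)" unfolding \<rho>k power_add ..
      finally have eq: "\<rho> ^ k * (2 ^ a * 3 ^ A) = 2 ^ (a - u * k) * 3 ^ (A + v * k)" .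
      show "\<exists>a\<ge>A. \<exists>b\<ge>A. 2 ^ a * 3 ^ b \<le> x \<and> x < (1 + e) * (2 ^ a * 3 ^ b)"
        by (rule exI[of _ "a - u * k"], rule conjI[OF ak(1)], rule exI[of _ "A + v * k"])
          (use k(2,3)[unfolded eq] in simp)
    qed
  next
    case False
    \<comment> \<open>Here each step consumes \<open>v\<close> factors 3, and the reserve is one of
      threes.\<close>
    show thesis
    proof (rule that[of "2 ^ A * 3 ^ (A + v * K)"])
      fix x :: real assume "2 ^ A * 3 ^ (A + v * K) \<le> x"
      then obtain a where a: "A \<le> a" "2 ^ a * 3 ^ (A + v * K) \<le> x" "x < 2 * (2 ^ a * 3 ^ (A + v * K))"
        using coarse[of "3 ^ (A + v * K)"] by auto
      obtain k where k: "k \<le> K" "\<rho> ^ k * (2 ^ a * 3 ^ (A + v * K)) \<le> x"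
        "x < (1 + e) * (\<rho> ^ k * (2 ^ a * 3 ^ (A + v * K)))"
        using fine[OF _ a(2,3)] by auto
      have "v * K = v * (K - k) + v * k" using k(1) by (simp flip: distrib_left)
      then have eq: "(3 :: real) ^ (A + v * K) = 3 ^ (A + v * (K - k)) * 3 ^ (v * k)"
        by (metis add.assoc power_add)
      have "\<rho> ^ k = 2 ^ (u * k) / 3 ^ (v * k)" using False by (simp add: \<rho>_def power_divide power_mult)
      then have eq': "\<rho> ^ k * (2 ^ a * 3 ^ (A + v * K)) = 2 ^ (a + u * k) * 3 ^ (A + v * (K - k))"
        unfolding eq by (simp add: power_add)
      show "\<exists>a\<ge>A. \<exists>b\<ge>A. 2 ^ a * 3 ^ b \<le> x \<and> x < (1 + e) * (2 ^ a * 3 ^ b)"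
        by (rule exI[of _ "a + u * k"], rule conjI[OF trans_le_add1[OF a(1)]],
            rule exI[of _ "A + v * (K - k)"])
          (use k(2,3)[unfolded eq'] in simp)
    qed
  qed
qed

section \<open>The limit inferior\<close>

text \<open>Take \<open>N = 2 ^ a * 3 ^ b\<close> slightly below the \<open>(l - 1)\<close>-st root
  of \<open>d\<close>, so that \<open>((2 ^ a + 1) * (3 ^ b + 1)) ^ (l - 1)\<close> is still at most
  \<open>d\<close>. The number of edges is at least \<open>N ^ (l * (l - 1))\<close>, which is
  \<open>d ^ l\<close> up to a factor near 1.\<close>

lemma eventually_h_greater:
  fixes c :: real
  assumes l: "2 \<le> l" and c: "0 < c" "c < 1"
  shows "\<forall>\<^sub>F d in sequentially. c < real (h l d) / real d ^ l"
proof -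
  define M where "M = l * (l - 1)"
  \<comment> \<open>The definition of \<open>x d\<close> and the density lemma each lose a factor
    \<open>1 + e\<close>. In the power \<open>M\<close> the loss is
    \<open>(1 + e) ^ (2 * M)\<close>, absorbed by the slack \<open>c < 1\<close>.\<close>
  have "((\<lambda>e. c * (1 + e) ^ (2 * M)) \<longlongrightarrow> c * (1 + 0) ^ (2 * M)) (at_right 0)"
    by (intro tendsto_intros)
  then have "\<forall>\<^sub>F e in at_right 0. c * (1 + e) ^ (2 * M) < 1"
    using c by (auto dest: order_tendstoD(2))
  then have "\<forall>\<^sub>F e in at_right 0. c * (1 + e) ^ (2 * M) < 1 \<and> 0 < e"
    using eventually_at_right_less[of "0 :: real"] by (rule eventually_conj)
  then obtain e :: real where e: "c * (1 + e) ^ (2 * M) < 1" "0 < e"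
    using eventually_happens'[OF trivial_limit_at_right_real] by blast
  \<comment> \<open>\<open>A\<close> bounds both exponents from below, so that passing from
    \<open>q\<close> to \<open>q + 1\<close> in both fields costs a factor below
    \<open>1 + e\<close>.\<close>
  have "((\<lambda>A. (1 + (1 / 2) ^ A) ^ 2) \<longlongrightarrow> (1 + 0 :: real) ^ 2) sequentially"
    by (intro tendsto_intros) simp_all
  from order_tendstoD(2)[OF this, of "1 + e"]
  have "\<forall>\<^sub>F A in sequentially. (1 + (1 / 2) ^ A) ^ 2 < 1 + e" using e by simp
  then have "\<forall>\<^sub>F A in sequentially. (1 + (1 / 2) ^ A) ^ 2 < 1 + e \<and> 0 < A"
    using eventually_gt_at_top[of 0] by (rule eventually_conj)
  then obtain A :: nat where A: "(1 + (1 / 2) ^ A) ^ 2 < 1 + e" "0 < A"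
    using eventually_happens'[OF sequentially_bot] by blast
  obtain x0 where x0: "\<And>x. x0 \<le> x \<Longrightarrow>
    \<exists>a\<ge>A. \<exists>b\<ge>A. 2 ^ a * 3 ^ b \<le> x \<and> x < (1 + e) * (2 ^ a * 3 ^ b)"
    using two_three_dense[OF e(2), of A] by metis
  \<comment> \<open>Dividing by \<open>1 + e\<close> reserves room for that cost, since
    \<open>d = ((1 + e) * x d) ^ (l - 1)\<close> for positive \<open>d\<close>.\<close>
  define x where "x d = real d powr (1 / real (l - 1)) / (1 + e)" for d
  have "filterlim x at_top sequentially"
    unfolding x_def using l e(2) by real_asymp
  then have "\<forall>\<^sub>F d in sequentially. x0 \<le> x d" by (simp add: filterlim_at_top)
  then have "\<forall>\<^sub>F d in sequentially. x0 \<le> x d \<and> 0 < d"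
    using eventually_gt_at_top[of 0] by (rule eventually_conj)
  then show ?thesis
  proof (rule eventually_mono)
    fix d assume d: "x0 \<le> x d \<and> 0 < d"
    then obtain a b where ab: "A \<le> a" "A \<le> b" "2 ^ a * 3 ^ b \<le> x d"
      "x d < (1 + e) * (2 ^ a * 3 ^ b)"
      using x0 by blast
    define N :: real where "N = 2 ^ a * 3 ^ b"
    have N: "0 < N" "N \<le> x d" "x d < (1 + e) * N" using ab by (auto simp: N_def)
    have d_eq: "real d = ((1 + e) * x d) ^ (l - 1)"
      using d l e(2) by (simp add: x_def powr_realpow[symmetric] powr_powr)
    have "1 = (2 :: real) ^ a * (1 / 2) ^ a" by (simp flip: power_mult_distrib)
    also have "\<dots> \<le> 2 ^ a * (1 / 2) ^ A" using ab by (intro mult_left_mono power_decreasing) auto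
    finally have pa: "(2 :: real) ^ a + 1 \<le> 2 ^ a * (1 + (1 / 2) ^ A)" by (simp add: distrib_left)
    have "1 = (3 :: real) ^ b * (1 / 3) ^ b" by (simp flip: power_mult_distrib)
    also have "\<dots> \<le> 3 ^ b * (1 / 2) ^ b" by (intro mult_left_mono power_mono) auto
    also have "\<dots> \<le> 3 ^ b * (1 / 2) ^ A" using ab by (intro mult_left_mono power_decreasing) auto
    finally have pb: "(3 :: real) ^ b + 1 \<le> 3 ^ b * (1 + (1 / 2) ^ A)" by (simp add: distrib_left)
    have "((2 :: real) ^ a + 1) * (3 ^ b + 1) \<le> (2 ^ a * (1 + (1 / 2) ^ A)) * (3 ^ b * (1 + (1 / 2) ^ A))"
      using pa pb by (intro mult_mono) auto
    also have "\<dots> = N * (1 + (1 / 2) ^ A) ^ 2" by (simp add: N_def power2_eq_square)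
    also have "\<dots> \<le> x d * (1 + e)" using N A by (intro mult_mono) auto
    finally have "(((2 :: real) ^ a + 1) * (3 ^ b + 1)) ^ (l - 1) \<le> ((1 + e) * x d) ^ (l - 1)"
      by (intro power_mono) (auto simp: mult.commute)
    then have "real (((2 ^ a + 1) * (3 ^ b + 1)) ^ (l - 1)) \<le> real d"
      using d_eq by (simp only: of_nat_power of_nat_mult of_nat_add of_nat_numeral of_nat_1)
    then have le: "((2 ^ a + 1) * (3 ^ b + 1)) ^ (l - 1) \<le> d" by (simp only: of_nat_le_iff)
    have "(2 ^ a * 3 ^ b) ^ M < h l d"
      unfolding M_def by (rule h_ge_two_three_powers[OF _ _ _ le]) (use ab A l in auto)
    then have "real ((2 ^ a * 3 ^ b) ^ M) < real (h l d)" by (simp only: of_nat_less_iff)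
    then have h: "N ^ M < real (h l d)" by (simp add: N_def)
    have "real d ^ l = ((1 + e) * x d) ^ M"
      unfolding d_eq M_def by (simp add: mult.commute flip: power_mult)
    also have "\<dots> \<le> ((1 + e) * ((1 + e) * N)) ^ M"
      using N e(2) by (intro power_mono mult_left_mono) auto
    also have "(1 + e) * ((1 + e) * N) = (1 + e) ^ 2 * N" by (simp add: power2_eq_square)
    also have "\<dots> ^ M = (1 + e) ^ (2 * M) * N ^ M" by (simp add: power_mult_distrib power_mult)
    finally have "c * real d ^ l \<le> c * (1 + e) ^ (2 * M) * N ^ M" using c by simp
    also have "\<dots> \<le> N ^ M" using e(1) N(1) by (simp add: mult_le_cancel_right1)
    finally have "c * real d ^ l < real (h l d)" using h by simp
    then show "c < real (h l d) / real d ^ l" using d by (simp add: pos_less_divide_eq)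
  qed
qed

theorem corollary1p2:
  fixes l :: nat
  assumes "l \<ge> 2"
  shows "liminf (\<lambda>d. ereal (real (h l d) / real d ^ l)) \<ge> 1"
  unfolding le_Liminf_iff
proof (intro allI impI)
  fix y :: ereal assume "y < 1"
  then obtain c where c: "y < ereal c" "ereal c < 1" using ereal_dense2 by blast
  \<comment> \<open>The real \<open>c\<close> may be negative; the maximum with \<open>1 / 2\<close>
    is a positive threshold below 1.\<close>
  then have "\<forall>\<^sub>F d in sequentially. max c (1 / 2) < real (h l d) / real d ^ l"
    by (intro eventually_h_greater assms) auto
  then show "\<forall>\<^sub>F d in sequentially. y < ereal (real (h l d) / real d ^ l)"
    by (rule eventually_mono) (use c in \<open>auto intro: less_trans\<close>)
qed

end
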